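(* Let $\ell\in\mathbb{N}$ and let $A\subseteq\mathbb{N}^\ell$ be an $\mathrm{IP}_0$ set in $(\mathbb{N}^\ell,+)$. For all $n,d\in\mathbb{N}$, $$\min_{\substack{1\le m_1,\dots,m_\ell\le M\\ (m_1,\dots,m_\ell)\in A}}\big\|\big(f_1(m_1,\dots,m_\ell),\dots,f_n(m_1,\dots,m_\ell)\big)\big\|\longrightarrow0\quad\text{as }M\to\infty,$$ uniformly over all polynomials $f_1,\dots,f_n\in\mathbb{R}[x_1,\dots,x_\ell]$ of degree at most $d$ with zero constant term.
   Context: $\|(y_1,\dots,y_n)\|$ denotes the Euclidean distance from $(y_1,\dots,y_n)$ to $0$ in the torus $(\mathbb{R}/\mathbb{Z})^n$. A set $B\subseteq\mathbb{N}^\ell$ is $\mathrm{IP}_r$ if there exist $s_1,\dots,s_r\in\mathbb{N}^\ell$ with $\sum_{i\in\alpha}s_i\in B$ for every nonempty $\alpha\subseteq\{1,\dots,r\}$, and $\mathrm{IP}_0$ if it is $\mathrm{IP}_r$ for every $r$. *)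

theory Defs
  imports "HOL-Analysis.Analysis" "HOL-Library.Poly_Mapping"
begin

text \<open>
  Here \<open>\<nat>\<close> is the semigroup of positive integers, so \<open>\<nat>\<^sup>\<ell>\<close> is the following
  subset of \<^typ>\<open>nat ^ 'l\<close>, where \<open>\<ell> = CARD('l)\<close>.  Admitting zero entries would make
  \<open>{0}\<close> an \<open>IP\<^sub>0\<close> set that contains no point with all coordinates at least 1.
\<close>

definition pos_vecs :: "(nat ^ 'l) set" where
  "pos_vecs = {m. \<forall>j. 1 \<le> m $ j}"

definition IP_rank :: "nat \<Rightarrow> (nat ^ 'l) set \<Rightarrow> bool" where
  "IP_rank r B \<longleftrightarrow>
     (\<exists>s :: nat \<Rightarrow> nat ^ 'l. (\<forall>i\<in>{1..r}. s i \<in> pos_vecs) \<and>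
        (\<forall>\<alpha>. \<alpha> \<subseteq> {1..r} \<and> \<alpha> \<noteq> {} \<longrightarrow> (\<Sum>i\<in>\<alpha>. s i) \<in> B))"

definition IP_zero :: "(nat ^ 'l) set \<Rightarrow> bool" where
  "IP_zero B \<longleftrightarrow> (\<forall>r. IP_rank r B)"

text \<open>
  Real polynomials in variables indexed by \<^typ>\<open>'l\<close>: finitely supported maps from monomials
  (finitely supported exponent functions) to coefficients.
\<close>

type_synonym 'l real_mpoly = "('l \<Rightarrow>\<^sub>0 nat) \<Rightarrow>\<^sub>0 real"

definition mpoly_eval :: "('l::finite) real_mpoly \<Rightarrow> real ^ 'l \<Rightarrow> real" where
  "mpoly_eval f x = (\<Sum>t\<in>Poly_Mapping.keys f.
     Poly_Mapping.lookup f t * (\<Prod>j\<in>UNIV. (x $ j) ^ Poly_Mapping.lookup t j))"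

text \<open>The zero polynomial gets degree 0, so it has degree at most \<open>d\<close> for every \<open>d\<close>.\<close>

definition mpoly_degree :: "('l::finite) real_mpoly \<Rightarrow> nat" where
  "mpoly_degree f =
     Max (insert 0 ((\<lambda>t. \<Sum>j\<in>UNIV. Poly_Mapping.lookup t j) ` Poly_Mapping.keys f))"

definition mpoly_const :: "('l::finite) real_mpoly \<Rightarrow> real" where
  "mpoly_const f = Poly_Mapping.lookup f 0"

text \<open>
  The quotient metric on the torus \<open>\<real>\<^sup>n / \<int>\<^sup>n\<close>: the distance from the class of \<open>y\<close> to the class
  of 0 is the Euclidean distance from \<open>y\<close> to the lattice \<open>\<int>\<^sup>n\<close>.
\<close>

definition torus_norm :: "real ^ 'n \<Rightarrow> real" where
  "torus_norm y = infdist y {k. \<forall>i. k $ i \<in> \<int>}"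

definition box_points :: "(nat ^ 'l) set \<Rightarrow> nat \<Rightarrow> (nat ^ 'l) set" where
  "box_points A M = {m \<in> A. \<forall>j. 1 \<le> m $ j \<and> m $ j \<le> M}"

definition min_torus_norm ::
  "(nat ^ 'l) set \<Rightarrow> nat \<Rightarrow> ('l::finite) real_mpoly ^ 'n \<Rightarrow> real" where
  "min_torus_norm A M f =
     Min ((\<lambda>m. torus_norm (\<chi> i. mpoly_eval (f $ i) (\<chi> j. real (m $ j)))) ` box_points A M)"

end

theory Submission
  imports Defs
begin

text \<open>
  For a polynomial \<open>F\<close> of degree at most \<open>d + 1\<close> vanishing at 0, the defect of additivity
  \<open>F (t + x) - F t - F x\<close> is, for fixed \<open>t\<close>, a polynomial in \<open>x\<close> of degree at most \<open>d\<close> vanishing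
  at 0.  By induction on the degree, applied to pairwise disjoint blocks of indices, choose block
  sums \<open>x\<^sub>0, x\<^sub>1, \<dots>\<close> one after the other, so that the defects of all the given polynomials with
  \<open>t = x\<^sub>i + \<dots> + x\<^sub>j\<^sub>-\<^sub>1\<close> and \<open>x = x\<^sub>j\<close> are nearly integers.  Then modulo 1 the value
  \<open>F (x\<^sub>i + \<dots> + x\<^sub>j\<^sub>-\<^sub>1)\<close> is nearly \<open>F (x\<^sub>0 + \<dots> + x\<^sub>j\<^sub>-\<^sub>1) - F (x\<^sub>0 + \<dots> + x\<^sub>i\<^sub>-\<^sub>1)\<close>, and the pigeonhole
  principle on the torus makes this small for some \<open>i < j\<close>.  The number of indices used depends
  only on the degree, the number of polynomials and the precision, which gives the uniformity.
\<close>

section \<open>Polynomial functions on commutative monoids\<close>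

text \<open>Degree at most \<open>d\<close> in the sense of iterated differences. With this
  coefficient-free notion, passing to the additivity defect lowers the degree by definition.\<close>

primrec poly_fun :: "nat \<Rightarrow> ('a::comm_monoid_add \<Rightarrow> real) \<Rightarrow> bool" where
  "poly_fun 0 F \<longleftrightarrow> (\<forall>x. F x = F 0)"
| "poly_fun (Suc d) F \<longleftrightarrow> (\<forall>h. poly_fun d (\<lambda>x. F (x + h) - F x))"

lemma poly_fun_const: "poly_fun d (\<lambda>_. c)"
  by (induction d arbitrary: c) auto

lemma poly_fun_Suc: "poly_fun d F \<Longrightarrow> poly_fun (Suc d) F"
proof (induction d arbitrary: F)
  case 0
  then have "F x = F 0" for x by simp
  then have "F (x + h) - F x = 0" for x h by (metis diff_self)
  then show ?case by simp
next
  case (Suc d)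
  then show ?case by (metis poly_fun.simps(2))
qed

lemma poly_fun_mono: "d \<le> e \<Longrightarrow> poly_fun d F \<Longrightarrow> poly_fun e F"
  by (induction rule: dec_induct) (blast intro: poly_fun_Suc)+

lemma poly_fun_add: "poly_fun d F \<Longrightarrow> poly_fun d G \<Longrightarrow> poly_fun d (\<lambda>x. F x + G x)"
proof (induction d arbitrary: F G)
  case 0
  then show ?case unfolding poly_fun.simps by metis
next
  case (Suc d)
  have "poly_fun d (\<lambda>x. (F (x + h) - F x) + (G (x + h) - G x))" for h
    using Suc by auto
  then show ?case by (simp add: algebra_simps)
qed

lemma poly_fun_cmult: "poly_fun d F \<Longrightarrow> poly_fun d (\<lambda>x. c * F x)"
proof (induction d arbitrary: F)
  case 0
  then show ?case unfolding poly_fun.simps by metis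
next
  case (Suc d)
  have "poly_fun d (\<lambda>x. c * (F (x + h) - F x))" for h
    using Suc by auto
  then show ?case by (simp add: algebra_simps)
qed

text \<open>Leibniz rule for differences: with dF, dG the differences of \<open>F\<close>,
  \<open>G\<close>, the difference of the product is dF G + F dG + dF dG. Each term has smaller
  total degree, hence strong induction on \<open>a + b\<close>.\<close>

lemma poly_fun_mult:
  "poly_fun a F \<Longrightarrow> poly_fun b G \<Longrightarrow> poly_fun (a + b) (\<lambda>x. F x * G x)"
proof (induction "a + b" arbitrary: a b F G rule: less_induct)
  case less
  show ?case
  proof (cases "a = 0 \<or> b = 0")
    \<comment> \<open>Taking differences lowers the index only from a successor, so a constant
      factor is treated as a scalar.\<close>
    case True
    then show ?thesis
    proof
      assume "a = 0"
      then have "F x = F 0" for x using less.prems(1) by (meson poly_fun.simps(1))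
      then have "(\<lambda>x. F x * G x) = (\<lambda>x. F 0 * G x)" by metis
      then show ?thesis
        using poly_fun_cmult[OF less.prems(2), of "F 0"] \<open>a = 0\<close> by simp
    next
      assume "b = 0"
      then have "G x = G 0" for x using less.prems(2) by (meson poly_fun.simps(1))
      then have "(\<lambda>x. F x * G x) = (\<lambda>x. G 0 * F x)" by (metis mult.commute)
      then show ?thesis
        using poly_fun_cmult[OF less.prems(1), of "G 0"] \<open>b = 0\<close> by simp
    qed
  next
    case False
    then obtain a' b' where ab: "a = Suc a'" "b = Suc b'"
      by (meson not0_implies_Suc)
    have "poly_fun (a' + b) (\<lambda>x. F (x + h) * G (x + h) - F x * G x)" for h
    proof -
      have F': "poly_fun a' (\<lambda>x. F (x + h) - F x)" and G': "poly_fun b' (\<lambda>x. G (x + h) - G x)"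
        using less.prems ab by auto
      have 1: "poly_fun (a' + b) (\<lambda>x. (F (x + h) - F x) * G x)"
        by (rule less.hyps[OF _ F' less.prems(2)]) (simp add: ab)
      have "poly_fun (a + b') (\<lambda>x. F x * (G (x + h) - G x))"
        by (rule less.hyps[OF _ less.prems(1) G']) (simp add: ab)
      then have 2: "poly_fun (a' + b) (\<lambda>x. F x * (G (x + h) - G x))"
        by (simp add: ab)
      have "poly_fun (a' + b') (\<lambda>x. (F (x + h) - F x) * (G (x + h) - G x))"
        by (rule less.hyps[OF _ F' G']) (simp add: ab)
      then have 3: "poly_fun (a' + b) (\<lambda>x. (F (x + h) - F x) * (G (x + h) - G x))"
        by (rule poly_fun_mono[rotated]) (simp add: ab)
      show ?thesis
        using poly_fun_add[OF poly_fun_add[OF 1 2] 3] by (simp add: algebra_simps)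
    qed
    then show ?thesis by (simp add: ab)
  qed
qed

lemma poly_fun_power: "poly_fun d F \<Longrightarrow> poly_fun (n * d) (\<lambda>x. F x ^ n)"
proof (induction n)
  case 0
  then show ?case by simp
next
  case (Suc n)
  then show ?case using poly_fun_mult[of d F "n * d" "\<lambda>x. F x ^ n"] by simp
qed

lemma poly_fun_prod:
  "(\<And>j. j \<in> J \<Longrightarrow> poly_fun (d j) (F j)) \<Longrightarrow> poly_fun (sum d J) (\<lambda>x. \<Prod>j\<in>J. F j x)"
  by (induction J rule: infinite_finite_induct) (auto intro: poly_fun_const poly_fun_mult)

lemma poly_fun_sum:
  "(\<And>j. j \<in> J \<Longrightarrow> poly_fun d (F j)) \<Longrightarrow> poly_fun d (\<lambda>x. \<Sum>j\<in>J. F j x)"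
  by (induction J rule: infinite_finite_induct) (auto intro: poly_fun_const poly_fun_add)

text \<open>Coordinates are additive, so they have constant differences and degree 1; powers,
  products and sums follow.\<close>

lemma poly_fun_mpoly_eval:
  assumes "mpoly_degree f \<le> d"
  shows "poly_fun d (mpoly_eval f)"
  unfolding mpoly_eval_def
proof (intro poly_fun_sum poly_fun_cmult)
  fix t assume t: "t \<in> Poly_Mapping.keys f"
  have "poly_fun (Poly_Mapping.lookup t j * 1) (\<lambda>x. (x $ j) ^ Poly_Mapping.lookup t j)"
    for j
    by (rule poly_fun_power) simp
  then have *: "poly_fun (\<Sum>j\<in>UNIV. Poly_Mapping.lookup t j)
      (\<lambda>x. \<Prod>j\<in>UNIV. (x $ j) ^ Poly_Mapping.lookup t j)"
    using poly_fun_prod[of UNIV "Poly_Mapping.lookup t"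
        "\<lambda>j x. (x $ j) ^ Poly_Mapping.lookup t j"] by simp
  have "(\<Sum>j\<in>UNIV. Poly_Mapping.lookup t j) \<le> mpoly_degree f"
    unfolding mpoly_degree_def using t by (intro Max_ge) auto
  then show "poly_fun d (\<lambda>x. \<Prod>j\<in>UNIV. (x $ j) ^ Poly_Mapping.lookup t j)"
    using * assms by (meson order_trans poly_fun_mono)
qed

lemma mpoly_eval_0: "mpoly_eval f 0 = mpoly_const f"
proof -
  \<comment> \<open>With \<open>0 ^ 0 = 1\<close>, only the constant monomial survives at the
    origin.\<close>
  have "(\<Prod>j\<in>UNIV. ((0 :: real ^ 'a) $ j) ^ Poly_Mapping.lookup t j) = (if t = 0 then 1 else 0)"
    for t :: "'a \<Rightarrow>\<^sub>0 nat"
  proof (cases "t = 0")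
    case False
    then obtain j where "Poly_Mapping.lookup t j \<noteq> 0"
      by (metis lookup_zero poly_mapping_eqI)
    then show ?thesis using False by (auto intro!: exI[of _ j])
  qed simp
  then show ?thesis
    by (simp add: mpoly_eval_def mpoly_const_def in_keys_iff if_distrib[of "(*) _"]
        del: zero_index cong: if_cong)
qed

section \<open>Recurrence along block sums\<close>

definition near_int :: "real \<Rightarrow> real \<Rightarrow> bool" where
  "near_int e x \<longleftrightarrow> (\<exists>z::int. \<bar>x - of_int z\<bar> \<le> e)"

lemma near_int_0: "0 \<le> e \<Longrightarrow> near_int e 0"
  unfolding near_int_def by (intro exI[of _ 0]) simp

lemma near_int_add: "near_int a x \<Longrightarrow> near_int b y \<Longrightarrow> near_int (a + b) (x + y)"
proof -
  assume "near_int a x" "near_int b y"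
  then obtain z w :: int where "\<bar>x - of_int z\<bar> \<le> a" "\<bar>y - of_int w\<bar> \<le> b"
    by (auto simp: near_int_def)
  then have "\<bar>(x + y) - of_int (z + w)\<bar> \<le> a + b" by simp
  then show ?thesis unfolding near_int_def by blast
qed

lemma near_int_minus: "near_int a x \<Longrightarrow> near_int a (- x)"
proof -
  assume "near_int a x"
  then obtain z :: int where "\<bar>x - of_int z\<bar> \<le> a" by (auto simp: near_int_def)
  then have "\<bar>- x - of_int (- z)\<bar> \<le> a" by simp
  then show ?thesis unfolding near_int_def by blast
qed

lemma near_int_diff: "near_int a x \<Longrightarrow> near_int b y \<Longrightarrow> near_int (a + b) (x - y)"
  using near_int_add[OF _ near_int_minus] by fastforce

lemma near_int_mono: "near_int a x \<Longrightarrow> a \<le> b \<Longrightarrow> near_int b x"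
  unfolding near_int_def by (meson order_trans)

text \<open>Fractional parts in the same of \<open>m\<close> intervals of length
  \<open>1 / m\<close> differ by at most \<open>1 / m\<close>, and \<open>x - y\<close> differs from
  their difference by an integer.\<close>

lemma near_int_diff_if_same_cell:
  assumes "\<lfloor>real m * frac x\<rfloor> = \<lfloor>real m * frac y\<rfloor>" "m > 0"
  shows "near_int (1 / m) (x - y)"
proof -
  have "\<bar>real m * frac x - real m * frac y\<bar> \<le> 1"
    using assms by linarith
  then have "real m * \<bar>frac x - frac y\<bar> \<le> 1"
    by (simp flip: right_diff_distrib add: abs_mult)
  then have "\<bar>(x - y) - of_int (\<lfloor>x\<rfloor> - \<lfloor>y\<rfloor>)\<bar> \<le> 1 / m"
    using assms(2) by (simp add: field_simps frac_def)
  then show ?thesis unfolding near_int_def by blast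
qed

text \<open>The torus splits into at most \<open>m ^ k\<close> cubes of side \<open>1 / m\<close>,
  while the indices 0 to \<open>m ^ k\<close> give one point more.\<close>

lemma torus_pigeonhole:
  fixes \<F> :: "('a \<Rightarrow> real) set" and S :: "nat \<Rightarrow> 'a"
  assumes "finite \<F>" "card \<F> \<le> k" and "m > (0 :: nat)"
  obtains i j where "i < j" "j \<le> m ^ k" "\<And>F. F \<in> \<F> \<Longrightarrow> near_int (1 / m) (F (S j) - F (S i))"
proof -
  \<comment> \<open>The cube containing the \<open>j\<close>-th point; the restricted lambda places
    it in an extensional function space, which is finite and can be counted.\<close>
  define c where "c j = (\<lambda>F\<in>\<F>. nat \<lfloor>real m * frac (F (S j))\<rfloor>)" for j
  have cell: "nat \<lfloor>real m * frac x\<rfloor> < m" for x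
  proof -
    have "real m * frac x < real m * 1"
      using \<open>m > 0\<close> frac_lt_1 by (intro mult_strict_left_mono) auto
    then show ?thesis using \<open>m > 0\<close> by (simp add: nat_less_iff floor_less_iff)
  qed
  have "c ` {..m ^ k} \<subseteq> \<F> \<rightarrow>\<^sub>E {..<m}"
    using cell by (auto simp: c_def)
  then have "card (c ` {..m ^ k}) \<le> card (\<F> \<rightarrow>\<^sub>E {..<m})"
    using assms by (intro card_mono finite_PiE) auto
  also have "\<dots> = m ^ card \<F>"
    using assms by (simp add: card_PiE)
  also have "\<dots> \<le> m ^ k"
    using assms by (intro power_increasing) auto
  finally have "\<not> inj_on c {..m ^ k}"
    using pigeonhole[of c "{..m ^ k}"] by simp
  then obtain i j where ij: "i < j" "j \<le> m ^ k" "c i = c j"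
    unfolding inj_on_def by (metis atMost_iff nat_neq_iff)
  have "near_int (1 / m) (F (S j) - F (S i))" if "F \<in> \<F>" for F
  proof (rule near_int_diff_if_same_cell[OF _ \<open>m > 0\<close>])
    have "c i F = c j F" using ij by simp
    moreover have "\<lfloor>real m * frac x\<rfloor> \<ge> 0" for x by simp
    ultimately show "\<lfloor>real m * frac (F (S j))\<rfloor> = \<lfloor>real m * frac (F (S i))\<rfloor>"
      using that by (simp add: c_def nat_eq_iff2)
  qed
  then show ?thesis using that ij by blast
qed

text \<open>Induction on the right end \<open>j\<close>: each new summand costs two defects, and the
  empty sum at \<open>j = i\<close> costs nothing because \<open>F 0 = 0\<close>.\<close>

lemma near_additivity:
  fixes F :: "'a::comm_monoid_add \<Rightarrow> real"
  assumes "F 0 = 0" "0 \<le> e"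
    and defect: "\<And>j i. j < n \<Longrightarrow> i \<le> j \<Longrightarrow>
      near_int e (F (sum x {i..<j} + x j) - F (sum x {i..<j}) - F (x j))"
    and "i \<le> j" "j \<le> n"
  shows "near_int (real (j - i) * (2 * e)) (F (sum x {i..<j}) - (F (sum x {..<j}) - F (sum x {..<i})))"
  using \<open>i \<le> j\<close> \<open>j \<le> n\<close>
proof (induction rule: dec_induct)
  case base
  then show ?case using assms(1) by (simp add: near_int_0)
next
  case (step j)
  then have IH: "near_int (real (j - i) * (2 * e))
      (F (sum x {i..<j}) - (F (sum x {..<j}) - F (sum x {..<i})))" by simp
  \<comment> \<open>The defects for the starting indices \<open>i\<close> and 0 both contain
    \<open>F (x j)\<close>, which cancels in their difference.\<close>
  have 1: "near_int e (F (sum x {i..<j} + x j) - F (sum x {i..<j}) - F (x j))"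
    using defect[of j i] step by simp
  have 2: "near_int e (F (sum x {..<j} + x j) - F (sum x {..<j}) - F (x j))"
    using defect[of j 0] step by (simp add: atLeast0LessThan)
  show ?case
    using near_int_add[OF IH near_int_diff[OF 1 2]] step
    by (simp add: algebra_simps Suc_diff_le)
qed

text \<open>The bound \<open>r\<close> precedes \<open>\<F>\<close> and \<open>s\<close>, which is
  the source of uniformity. The induction generalizes \<open>k\<close> and \<open>e\<close>, since
  degree \<open>d\<close> is used for more functions and a finer precision.\<close>

lemma poly_fun_recurrence:
  assumes "e > 0"
  shows "\<exists>r. \<forall>(\<F> :: ('a::comm_monoid_add \<Rightarrow> real) set) (s :: nat \<Rightarrow> 'a).
    finite \<F> \<longrightarrow> card \<F> \<le> k \<longrightarrow> (\<forall>F\<in>\<F>. poly_fun d F \<and> F 0 = 0) \<longrightarrow>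
    (\<exists>\<alpha> \<subseteq> {..<r}. \<alpha> \<noteq> {} \<and> (\<forall>F\<in>\<F>. near_int e (F (sum s \<alpha>))))"
  using assms
proof (induction d arbitrary: k e)
  case 0
  show ?case
  \<comment> \<open>A constant function vanishing at 0 is zero, so one index suffices.\<close>
  proof (rule exI[of _ 1], intro allI impI)
    fix \<F> :: "('a \<Rightarrow> real) set" and s :: "nat \<Rightarrow> 'a"
    assume "\<forall>F\<in>\<F>. poly_fun 0 F \<and> F 0 = 0"
    then have "\<forall>F\<in>\<F>. near_int e (F (sum s {0}))"
      using 0 unfolding poly_fun.simps by (metis less_imp_le near_int_0)
    then show "\<exists>\<alpha>\<subseteq>{..<1}. \<alpha> \<noteq> {} \<and> (\<forall>F\<in>\<F>. near_int e (F (sum s \<alpha>)))"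
      by (intro exI[of _ "{0}"]) auto
  qed
next
  case (Suc d)
  obtain m :: nat where m: "m > 0" "1 / m < e / 2"
    using Suc.prems by (metis half_gt_zero nat_approx_posE zero_less_Suc)
  \<comment> \<open>The number of blocks: \<open>N\<close> blocks have \<open>N + 1\<close> initial
    sums, as the pigeonhole principle requires.\<close>
  define N where "N = m ^ k"
  have "N > 0" using m by (simp add: N_def)
  \<comment> \<open>At most \<open>N\<close> steps of near additivity, each costing
    \<open>2 * e'\<close>, add up to at most \<open>e / 2\<close>.\<close>
  define e' where "e' = e / (4 * N)"
  have "e' > 0" using Suc.prems \<open>N > 0\<close> by (simp add: e'_def)
  from Suc.IH[OF this, of "N * k"] obtain r where
    "\<forall>(\<F> :: ('a \<Rightarrow> real) set) (s :: nat \<Rightarrow> 'a).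
      finite \<F> \<longrightarrow> card \<F> \<le> N * k \<longrightarrow> (\<forall>F\<in>\<F>. poly_fun d F \<and> F 0 = 0) \<longrightarrow>
      (\<exists>\<alpha> \<subseteq> {..<r}. \<alpha> \<noteq> {} \<and> (\<forall>F\<in>\<F>. near_int e' (F (sum s \<alpha>))))"
    by (rule exE)
  note r = this[THEN spec, THEN spec, THEN mp, THEN mp, THEN mp]
  show ?case
  proof (rule exI[of _ "N * r"], intro allI impI)
    fix \<F> :: "('a \<Rightarrow> real) set" and s :: "nat \<Rightarrow> 'a"
    assume fin: "finite \<F>" and card: "card \<F> \<le> k"
      and poly: "\<forall>F\<in>\<F>. poly_fun (Suc d) F \<and> F 0 = 0"
    \<comment> \<open>Blocks are built one by one in consecutive intervals of length
      \<open>r\<close>. The bound \<open>n \<le> N\<close> keeps the number of defects at each stage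
      within \<open>N * k\<close>.\<close>
    have "\<exists>A. \<forall>j<n. A j \<subseteq> {j * r..<Suc j * r} \<and> A j \<noteq> {} \<and>
        (\<forall>i\<le>j. \<forall>F\<in>\<F>. near_int e' (F ((\<Sum>h=i..<j. sum s (A h)) + sum s (A j))
           - F (\<Sum>h=i..<j. sum s (A h)) - F (sum s (A j))))"
      if "n \<le> N" for n
      using that
    proof (induction n)
      case 0
      then show ?case by simp
    next
      case (Suc n)
      then obtain A where A: "\<forall>j<n. A j \<subseteq> {j * r..<Suc j * r} \<and> A j \<noteq> {} \<and>
        (\<forall>i\<le>j. \<forall>F\<in>\<F>. near_int e' (F ((\<Sum>h=i..<j. sum s (A h)) + sum s (A j))
           - F (\<Sum>h=i..<j. sum s (A h)) - F (sum s (A j))))"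
        by auto
      define T where "T i = (\<Sum>h=i..<n. sum s (A h))" for i
      define D where "D = (\<lambda>(i, F) x. F (T i + x) - F (T i) - F x :: real)"
      define \<G> where "\<G> = D ` ({..n} \<times> \<F>)"
      have "card \<G> \<le> card ({..n} \<times> \<F>)"
        unfolding \<G>_def using fin by (intro card_image_le) auto
      also have "\<dots> \<le> N * k"
        using mult_le_mono[OF Suc.prems card] by (simp add: card_cartesian_product)
      finally have "card \<G> \<le> N * k" .
      moreover have "finite \<G>" unfolding \<G>_def using fin by auto
      moreover have "\<forall>G\<in>\<G>. poly_fun d G \<and> G 0 = 0"
      proof
        fix G assume "G \<in> \<G>"
        then obtain i F where F: "F \<in> \<F>" "G = D (i, F)" unfolding \<G>_def by auto
        \<comment> \<open>The defect is the difference of \<open>F\<close> in direction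
          \<open>T i\<close>, shifted by a constant, so its degree is at most
          \<open>d\<close>.\<close>
        have "poly_fun d (\<lambda>x. (F (x + T i) - F x) + (- F (T i)))"
          using poly F by (intro poly_fun_add poly_fun_const) auto
        moreover have "G = (\<lambda>x. (F (x + T i) - F x) + (- F (T i)))"
          unfolding F D_def by (auto simp: add.commute)
        ultimately show "poly_fun d G \<and> G 0 = 0"
          using poly F by (auto simp: D_def)
      qed
      ultimately obtain \<alpha> where \<alpha>: "\<alpha> \<subseteq> {..<r}" "\<alpha> \<noteq> {}"
        \<comment> \<open>Shifting \<open>s\<close> by \<open>n * r\<close> moves the index set into
          the \<open>n\<close>-th interval.\<close>
        "\<forall>G\<in>\<G>. near_int e' (G (sum (\<lambda>i. s (n * r + i)) \<alpha>))"
        using r[of \<G> "\<lambda>i. s (n * r + i)"] by meson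
      define B where "B = (+) (n * r) ` \<alpha>"
      have sumB: "sum s B = sum (\<lambda>i. s (n * r + i)) \<alpha>"
        unfolding B_def by (subst sum.reindex) auto
      \<comment> \<open>The conditions for \<open>j < n\<close> involve only blocks up to
        \<open>j\<close>, so they survive this update.\<close>
      define A' where "A' = A(n := B)"
      have A'_less: "A' j = A j" if "j < n" for j using that by (simp add: A'_def)
      have sumA': "(\<Sum>h=i..<j. sum s (A' h)) = (\<Sum>h=i..<j. sum s (A h))" if "j \<le> n" for i j
        using that by (intro sum.cong) (auto simp: A'_less)
      have "A' j \<subseteq> {j * r..<Suc j * r} \<and> A' j \<noteq> {} \<and>
        (\<forall>i\<le>j. \<forall>F\<in>\<F>. near_int e' (F ((\<Sum>h=i..<j. sum s (A' h)) + sum s (A' j))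
           - F (\<Sum>h=i..<j. sum s (A' h)) - F (sum s (A' j))))" if "j < Suc n" for j
      proof (cases "j = n")
        case True
        have "B \<subseteq> {n * r..<Suc n * r}" "B \<noteq> {}"
          using \<alpha> unfolding B_def by auto
        moreover have "near_int e' (F (T i + sum s B) - F (T i) - F (sum s B))"
          if "i \<le> n" "F \<in> \<F>" for i F
        proof -
          have "D (i, F) \<in> \<G>" using that by (auto simp: \<G>_def)
          then have "near_int e' (D (i, F) (sum s B))" using \<alpha>(3) sumB by simp
          then show ?thesis by (simp add: D_def)
        qed
        ultimately show ?thesis unfolding True by (simp add: sumA' T_def A'_def)
      next
        case False
        then have "j < n" using that by simp
        then show ?thesis using A by (simp add: A'_less sumA')
      qed
      then show ?case by blast
    qed
    from this[OF order.refl] obtain A where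
      "\<forall>j<N. A j \<subseteq> {j * r..<Suc j * r} \<and> A j \<noteq> {} \<and>
        (\<forall>i\<le>j. \<forall>F\<in>\<F>. near_int e' (F ((\<Sum>h=i..<j. sum s (A h)) + sum s (A j))
           - F (\<Sum>h=i..<j. sum s (A h)) - F (sum s (A j))))"
      by (rule exE)
    then have A: "\<And>j. j < N \<Longrightarrow> A j \<subseteq> {j * r..<Suc j * r}" "\<And>j. j < N \<Longrightarrow> A j \<noteq> {}"
      "\<And>j i F. j < N \<Longrightarrow> i \<le> j \<Longrightarrow> F \<in> \<F> \<Longrightarrow>
        near_int e' (F ((\<Sum>h=i..<j. sum s (A h)) + sum s (A j))
          - F (\<Sum>h=i..<j. sum s (A h)) - F (sum s (A j)))"
      by simp_all
    obtain i j where ij: "i < j" "j \<le> N"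
      "\<And>F. F \<in> \<F> \<Longrightarrow> near_int (1 / m) (F (\<Sum>h<j. sum s (A h)) - F (\<Sum>h<i. sum s (A h)))"
      by (rule torus_pigeonhole[OF fin card m(1), of "\<lambda>j. \<Sum>h<j. sum s (A h)", folded N_def])
        (rule that)
    \<comment> \<open>The blocks between the two initial sums found by pigeonhole; as the blocks are
      disjoint, the sum over this union is the sum of the block sums.\<close>
    define \<alpha> where "\<alpha> = (\<Union>h\<in>{i..<j}. A h)"
    have "\<alpha> \<subseteq> {..<N * r}"
    proof
      fix x assume "x \<in> \<alpha>"
      then obtain h where h: "h < j" "x \<in> A h" unfolding \<alpha>_def by auto
      then have "h < N" "x < Suc h * r" using A(1)[of h] ij by auto
      moreover from \<open>h < N\<close> have "Suc h * r \<le> N * r" by (intro mult_right_mono) auto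
      ultimately show "x \<in> {..<N * r}" by simp
    qed
    moreover have "\<alpha> \<noteq> {}" using A(2)[of i] ij by (auto simp: \<alpha>_def)
    moreover have "near_int e (F (sum s \<alpha>))" if F: "F \<in> \<F>" for F
    proof -
      have finA: "finite (A h)" if "h < N" for h
        using A(1)[OF that] by (rule finite_subset) simp
      have disj: "A h \<inter> A h' = {}" if "h < h'" "h' < N" for h h'
      proof -
        have "Suc h * r \<le> h' * r" using that by (intro mult_right_mono) auto
        then show ?thesis using A(1)[of h] A(1)[of h'] that by fastforce
      qed
      have sum\<alpha>: "sum s \<alpha> = (\<Sum>h=i..<j. sum s (A h))"
        unfolding \<alpha>_def
      proof (rule sum.UNION_disjoint)
        show "\<forall>h\<in>{i..<j}. \<forall>h'\<in>{i..<j}. h \<noteq> h' \<longrightarrow> A h \<inter> A h' = {}"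
          using disj ij by (metis Int_commute atLeastLessThan_iff nat_neq_iff order_less_le_trans)
      qed (use finA ij in auto)
      have "near_int (real (j - i) * (2 * e'))
         (F (sum s \<alpha>) - (F (\<Sum>h<j. sum s (A h)) - F (\<Sum>h<i. sum s (A h))))"
        unfolding sum\<alpha>
      proof (rule near_additivity[where n = N and x = "\<lambda>h. sum s (A h)"])
        show "F 0 = 0" using poly F by blast
      qed (use \<open>e' > 0\<close> ij A(3) F in simp_all)
      \<comment> \<open>The difference of the two initial values cancels, leaving
        \<open>F (sum s \<alpha>)\<close> with both errors added.\<close>
      from near_int_add[OF this ij(3)[OF F]]
      have *: "near_int (real (j - i) * (2 * e') + 1 / m) (F (sum s \<alpha>))" by simp
      have "real (j - i) * (2 * e') \<le> real N * (2 * e')"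
        using ij \<open>e' > 0\<close> by (intro mult_right_mono) auto
      also have "\<dots> = e / 2" using \<open>N > 0\<close> by (simp add: e'_def)
      finally show ?thesis using m by (intro near_int_mono[OF *]) simp
    qed
    ultimately show "\<exists>\<alpha>\<subseteq>{..<N * r}. \<alpha> \<noteq> {} \<and> (\<forall>F\<in>\<F>. near_int e (F (sum s \<alpha>)))"
      by blast
  qed
qed

section \<open>Uniform recurrence on the torus\<close>

text \<open>Rounding each coordinate gives a lattice point; the Euclidean norm is at most the sum of
  absolute coordinates.\<close>

lemma torus_norm_le:
  fixes y :: "real ^ 'n"
  assumes "\<And>i. near_int e (y $ i)"
  shows "torus_norm y \<le> real CARD('n) * e"
proof -
  obtain z :: "'n \<Rightarrow> int" where z: "\<And>i. \<bar>y $ i - of_int (z i)\<bar> \<le> e"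
    using assms unfolding near_int_def by metis
  define k :: "real ^ 'n" where "k = (\<chi> i. of_int (z i))"
  have "torus_norm y \<le> dist y k"
    unfolding torus_norm_def by (rule infdist_le) (simp add: k_def)
  also have "\<dots> \<le> (\<Sum>i\<in>UNIV. \<bar>(y - k) $ i\<bar>)"
    unfolding dist_norm by (rule norm_le_l1_cart)
  also have "\<dots> \<le> (\<Sum>i\<in>(UNIV :: 'n set). e)"
    using z by (intro sum_mono) (simp add: k_def)
  finally show ?thesis by simp
qed

section \<open>Minima over boxes and finite sums inside an \<open>IP_zero\<close> set\<close>

lemma finite_box_points: "finite (box_points (A :: (nat ^ 'l::finite) set) M)"
proof -
  have "box_points A M \<subseteq> vec_lambda ` (UNIV \<rightarrow>\<^sub>E {..M})"
  proof
    fix m assume "m \<in> box_points A M"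
    then show "m \<in> vec_lambda ` (UNIV \<rightarrow>\<^sub>E {..M})"
      by (intro image_eqI[of _ _ "vec_nth m"]) (auto simp: box_points_def)
  qed
  then show ?thesis by (rule finite_subset) (intro finite_imageI finite_PiE; simp)
qed

text \<open>The witness \<open>m\<close> makes the set nonempty, so that \<open>Min\<close> is a
  true minimum.\<close>

lemma min_torus_norm_bounds:
  assumes "m \<in> box_points A M"
  shows "0 \<le> min_torus_norm A M f"
    and "min_torus_norm A M f \<le> torus_norm (\<chi> i. mpoly_eval (f $ i) (\<chi> j. real (m $ j)))"
proof -
  show "0 \<le> min_torus_norm A M f"
    unfolding min_torus_norm_def using assms finite_box_points[of A M]
    by (subst Min_ge_iff) (auto simp: torus_norm_def infdist_nonneg)
  show "min_torus_norm A M f \<le> torus_norm (\<chi> i. mpoly_eval (f $ i) (\<chi> j. real (m $ j)))"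
    unfolding min_torus_norm_def using assms finite_box_points[of A M] by (intro Min_le) auto
qed

lemma IP_zero_finite_sums:
  fixes A :: "(nat ^ 'l::finite) set"
  assumes "A \<subseteq> pos_vecs" "IP_zero A"
  obtains s :: "nat \<Rightarrow> nat ^ 'l" and M where
    "\<And>\<alpha> M'. \<alpha> \<subseteq> {..<r} \<Longrightarrow> \<alpha> \<noteq> {} \<Longrightarrow> M \<le> M' \<Longrightarrow> sum s \<alpha> \<in> box_points A M'"
proof -
  from assms(2) obtain s where s: "\<And>\<alpha>. \<alpha> \<subseteq> {1..r} \<Longrightarrow> \<alpha> \<noteq> {} \<Longrightarrow> sum s \<alpha> \<in> A"
    unfolding IP_zero_def IP_rank_def by metis
  \<comment> \<open>All coordinates of all generators together bound every coordinate of every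
    subset sum.\<close>
  define M where "M = (\<Sum>j\<in>UNIV. \<Sum>i<r. s (Suc i) $ j)"
  have "sum (s \<circ> Suc) \<alpha> \<in> box_points A M'"
    if "\<alpha> \<subseteq> {..<r}" "\<alpha> \<noteq> {}" "M \<le> M'" for \<alpha> M'
  proof -
    have "sum s (Suc ` \<alpha>) \<in> A" using that by (intro s) auto
    then have A: "sum (s \<circ> Suc) \<alpha> \<in> A" by (simp add: sum.reindex)
    have "sum (s \<circ> Suc) \<alpha> $ j \<le> M'" for j
    proof -
      have "sum (s \<circ> Suc) \<alpha> $ j = (\<Sum>i\<in>\<alpha>. s (Suc i) $ j)" by simp
      also have "\<dots> \<le> (\<Sum>i<r. s (Suc i) $ j)" using that by (intro sum_mono2) auto
      also have "\<dots> \<le> M" unfolding M_def by (rule member_le_sum) auto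
      finally show ?thesis using that by simp
    qed
    then show ?thesis using A assms(1) by (auto simp: box_points_def pos_vecs_def)
  qed
  then show ?thesis using that by blast
qed

text \<open>Eventual nonemptiness of the boxes is stated along with the limit, as \<open>Min\<close>
  of an empty set carries no information.\<close>

theorem theorem7p9:
  fixes A :: "(nat ^ 'l) set" and d :: nat
  assumes "A \<subseteq> pos_vecs" and "IP_zero A"
  shows "(\<forall>\<^sub>F M in sequentially. box_points A M \<noteq> {}) \<and>
    uniform_limit
      {f :: ('l::finite) real_mpoly ^ 'n. \<forall>i. mpoly_degree (f $ i) \<le> d \<and> mpoly_const (f $ i) = 0}
      (\<lambda>M f. min_torus_norm A M f) (\<lambda>f. 0) sequentially"
proof
  obtain s :: "nat \<Rightarrow> nat ^ 'l" and M where
    "\<And>\<alpha> M'. \<alpha> \<subseteq> {..<1} \<Longrightarrow> \<alpha> \<noteq> {} \<Longrightarrow> M \<le> M' \<Longrightarrow> sum s \<alpha> \<in> box_points A M'"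
    using IP_zero_finite_sums[OF assms] by metis
  from this[of "{0}"] show "\<forall>\<^sub>F M in sequentially. box_points A M \<noteq> {}"
    unfolding eventually_sequentially by blast
next
  show "uniform_limit
      {f :: 'l real_mpoly ^ 'n. \<forall>i. mpoly_degree (f $ i) \<le> d \<and> mpoly_const (f $ i) = 0}
      (\<lambda>M f. min_torus_norm A M f) (\<lambda>f. 0) sequentially"
  proof (rule uniform_limitI)
    fix e :: real assume "e > 0"
    \<comment> \<open>The factor 2 turns the non-strict bound from \<open>torus_norm_le\<close> into
      a strict one.\<close>
    define e' where "e' = e / (2 * CARD('n))"
    have "e' > 0" using \<open>e > 0\<close> by (simp add: e'_def)
    from poly_fun_recurrence[OF this, of "CARD('n)" d] obtain r where
      "\<forall>(\<F> :: (real ^ 'l \<Rightarrow> real) set) (s :: nat \<Rightarrow> real ^ 'l).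
        finite \<F> \<longrightarrow> card \<F> \<le> CARD('n) \<longrightarrow> (\<forall>F\<in>\<F>. poly_fun d F \<and> F 0 = 0) \<longrightarrow>
        (\<exists>\<alpha> \<subseteq> {..<r}. \<alpha> \<noteq> {} \<and> (\<forall>F\<in>\<F>. near_int e' (F (sum s \<alpha>))))"
      by (rule exE)
    note r = this[THEN spec, THEN spec, THEN mp, THEN mp, THEN mp]
    \<comment> \<open>Both \<open>r\<close> and \<open>M\<close> are fixed before any
      \<open>f\<close>, which makes the convergence uniform.\<close>
    obtain s :: "nat \<Rightarrow> nat ^ 'l" and M where
      s: "\<And>\<alpha> M'. \<alpha> \<subseteq> {..<r} \<Longrightarrow> \<alpha> \<noteq> {} \<Longrightarrow> M \<le> M' \<Longrightarrow> sum s \<alpha> \<in> box_points A M'"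
      using IP_zero_finite_sums[OF assms] by metis
    have "dist (min_torus_norm A M' f) 0 < e"
      if "M \<le> M'" and f: "\<forall>i. mpoly_degree (f $ i) \<le> d \<and> mpoly_const (f $ i) = 0"
      for M' and f :: "'l real_mpoly ^ 'n"
    proof -
      define \<F> where "\<F> = range (\<lambda>i. mpoly_eval (f $ i))"
      have "\<forall>F\<in>\<F>. poly_fun d F \<and> F 0 = 0"
        using f by (auto simp: \<F>_def mpoly_eval_0 poly_fun_mpoly_eval)
      moreover have "finite \<F>" "card \<F> \<le> CARD('n)"
        by (auto simp: \<F>_def intro: card_image_le)
      ultimately obtain \<alpha> where \<alpha>: "\<alpha> \<subseteq> {..<r}" "\<alpha> \<noteq> {}"
        "\<forall>F\<in>\<F>. near_int e' (F (\<Sum>i\<in>\<alpha>. \<chi> j. real (s i $ j)))"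
        using r[of \<F> "\<lambda>i. \<chi> j. real (s i $ j)"] by meson
      \<comment> \<open>The embedding of natural into real vectors is additive, so the real sum
        comes from a point of \<open>A\<close>.\<close>
      have "(\<chi> j. real (sum s \<alpha> $ j)) = (\<Sum>i\<in>\<alpha>. \<chi> j. real (s i $ j))"
        by (simp add: vec_eq_iff)
      then have "near_int e' (mpoly_eval (f $ i) (\<chi> j. real (sum s \<alpha> $ j)))" for i
        using \<alpha>(3) by (simp add: \<F>_def)
      then have "torus_norm (\<chi> i. mpoly_eval (f $ i) (\<chi> j. real (sum s \<alpha> $ j))) \<le> CARD('n) * e'"
        by (intro torus_norm_le) simp
      also have "\<dots> < e" using \<open>e > 0\<close> by (simp add: e'_def)
      finally show ?thesis
        using min_torus_norm_bounds[OF s[OF \<alpha>(1,2) that(1)], of f] by simp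
    qed
    then show "\<forall>\<^sub>F M in sequentially. \<forall>f\<in>{f :: 'l real_mpoly ^ 'n.
        \<forall>i. mpoly_degree (f $ i) \<le> d \<and> mpoly_const (f $ i) = 0}.
        dist (min_torus_norm A M f) 0 < e"
      unfolding eventually_sequentially by blast
  qed
qed

end
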